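(* Every Alster topological space is Menger.
   Context: A topological space $X$ is *Alster* if the following holds: whenever $\mathcal{G}$ is a cover of $X$ by $G_\delta$ subsets of $X$ such that every compact subset of $X$ is included in the union of finitely many members of $\mathcal{G}$, then $\mathcal{G}$ has a countable subfamily covering $X$. A topological space $X$ is *Menger* if for each sequence $\{\mathcal{U}_n\}_{n<\omega}$ of open covers of $X$ such that each finite union of elements of $\mathcal{U}_n$ is a member of $\mathcal{U}_n$, there are $U_n\in\mathcal{U}_n$ ($n<\omega$) such that $\{U_n : n<\omega\}$ is an open cover of $X$. *)

theory Defs
  imports "HOL-Analysis.Analysis"
begin

definition Alster_space :: "'a topology \<Rightarrow> bool" where
  "Alster_space X \<longleftrightarrow>
     (\<forall>\<G>. (\<forall>G\<in>\<G>. gdelta_in X G) \<and> \<Union>\<G> = topspace X \<and>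
          (\<forall>K. compactin X K \<longrightarrow> (\<exists>\<F>. finite \<F> \<and> \<F> \<subseteq> \<G> \<and> K \<subseteq> \<Union>\<F>))
        \<longrightarrow> (\<exists>\<C>. countable \<C> \<and> \<C> \<subseteq> \<G> \<and> \<Union>\<C> = topspace X))"

definition open_cover_of :: "'a topology \<Rightarrow> 'a set set \<Rightarrow> bool" where
  "open_cover_of X \<U> \<longleftrightarrow> (\<forall>U\<in>\<U>. openin X U) \<and> \<Union>\<U> = topspace X"

(* Finite unions include the empty one, so every cover considered contains {}.  For nonempty X
   this makes no difference: adding {} to a cover closed under nonempty finite unions is harmless,
   since a selected {} can be replaced by any member of the cover.  It matters only for the empty
   space, whose empty open cover offers nothing to select; the empty space is thus Menger. *)
definition Menger_space :: "'a topology \<Rightarrow> bool" where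
  "Menger_space X \<longleftrightarrow>
     (\<forall>\<U> :: nat \<Rightarrow> 'a set set.
        (\<forall>n. open_cover_of X (\<U> n) \<and>
             (\<forall>\<F>. finite \<F> \<and> \<F> \<subseteq> \<U> n \<longrightarrow> \<Union>\<F> \<in> \<U> n))
        \<longrightarrow> (\<exists>U. (\<forall>n. U n \<in> \<U> n) \<and> open_cover_of X (range U)))"

end

theory Submission
  imports Defs
begin

text \<open>Consider the family of all intersections \<open>\<Inter>n. V n\<close> with \<open>V n \<in> \<U> n\<close>.  Since each \<open>\<U> n\<close> is
  closed under finite unions, every compact set lies in a single member of \<open>\<U> n\<close> for each \<open>n\<close>,
  hence in a single member of this family.  If the members given by \<open>V\<^sub>0, V\<^sub>1, \<dots>\<close> cover
  \<open>X\<close>, then so do the diagonal sets \<open>V\<^sub>n n\<close>.\<close>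

text \<open>A finite subcover of \<open>K\<close> collapses to its union, which closure under finite
  unions puts back into \<open>\<U>\<close>; an empty \<open>K\<close> is served by the empty
  union.\<close>

lemma compactin_subset_member_directed_cover:
  assumes K: "compactin X K" and cover: "open_cover_of X \<U>"
    and Un: "\<And>\<F>. finite \<F> \<Longrightarrow> \<F> \<subseteq> \<U> \<Longrightarrow> \<Union>\<F> \<in> \<U>"
  obtains U where "U \<in> \<U>" "K \<subseteq> U"
proof -
  have "K \<subseteq> \<Union>\<U>"
    using K cover by (simp add: open_cover_of_def compactin_def)
  then obtain \<F> where "finite \<F>" "\<F> \<subseteq> \<U>" "K \<subseteq> \<Union>\<F>"
    using K cover unfolding compactin_def open_cover_of_def by meson
  then show thesis
    using Un that by blast
qed

theorem theorem4:
  fixes X :: "'a topology"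
  assumes "Alster_space X"
  shows "Menger_space X"
  unfolding Menger_space_def
proof (intro allI impI)
  fix \<U> :: "nat \<Rightarrow> 'a set set"
  assume "\<forall>n. open_cover_of X (\<U> n) \<and> (\<forall>\<F>. finite \<F> \<and> \<F> \<subseteq> \<U> n \<longrightarrow> \<Union>\<F> \<in> \<U> n)"
  then have cover: "open_cover_of X (\<U> n)"
    and Un: "finite \<F> \<Longrightarrow> \<F> \<subseteq> \<U> n \<Longrightarrow> \<Union>\<F> \<in> \<U> n" for n \<F>
    by blast+
  have opn: "openin X U" if "U \<in> \<U> n" for U n
    using cover[of n] that by (auto simp: open_cover_of_def)
  define \<V> where "\<V> = {V. \<forall>n. V n \<in> \<U> n}"
  define \<G> where "\<G> = (\<lambda>V. \<Inter>n. V n) ` \<V>"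
  have gdelta: "gdelta_in X G" if G: "G \<in> \<G>" for G
  proof -
    obtain V where "V \<in> \<V>" "G = (\<Inter>n. V n)"
      using G by (auto simp: \<G>_def)
    then have "gdelta_in X (V n)" for n
      using opn open_imp_gdelta_in unfolding \<V>_def by blast
    then show ?thesis
      unfolding \<open>G = (\<Inter>n. V n)\<close> by (intro gdelta_in_Inter) auto
  qed
  have compact: "\<exists>G\<in>\<G>. K \<subseteq> G" if K: "compactin X K" for K
  proof -
    have "\<exists>U. U \<in> \<U> n \<and> K \<subseteq> U" for n
      using compactin_subset_member_directed_cover[OF K cover Un] by blast
    then obtain V where "\<And>n. V n \<in> \<U> n \<and> K \<subseteq> V n"
      by metis
    then show ?thesis
      by (auto simp: \<G>_def \<V>_def)
  qed
  have "topspace X \<subseteq> \<Union>\<G>"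
  proof
    fix x assume "x \<in> topspace X"
    then show "x \<in> \<Union>\<G>"
      \<comment> \<open>Singletons are compact, so covering the points is a special case of
        \<open>compact\<close>.\<close>
      using compact[of "{x}"] by auto
  qed
  then have "\<Union>\<G> = topspace X"
    using gdelta gdelta_in_subset by blast
  moreover have "\<exists>\<F>. finite \<F> \<and> \<F> \<subseteq> \<G> \<and> K \<subseteq> \<Union>\<F>" if K: "compactin X K" for K
  proof -
    obtain G where "G \<in> \<G>" "K \<subseteq> G"
      using compact[OF K] by blast
    then show ?thesis
      by (intro exI[of _ "{G}"]) auto
  qed
  ultimately obtain \<C> where \<C>: "countable \<C>" "\<C> \<subseteq> \<G>" "\<Union>\<C> = topspace X"
    using assms gdelta unfolding Alster_space_def by meson
  \<comment> \<open>The diagonal needs the sequences themselves, not just their intersections, so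
    one sequence is chosen for each member of \<open>\<C>\<close>; this keeps \<open>\<W>\<close>
    countable.\<close>
  obtain \<W> where \<W>: "countable \<W>" "\<W> \<subseteq> \<V>" "\<C> = (\<lambda>V. \<Inter>n. V n) ` \<W>"
    using \<C> unfolding \<G>_def by (metis countable_subset_image)
  \<comment> \<open>The empty union puts \<open>{}\<close> into every \<open>\<U> n\<close>.\<close>
  have "(\<lambda>n. {}) \<in> \<V>"
    using Un[of "{}"] by (simp add: \<V>_def)
  \<comment> \<open>The additional sequence makes the enumerated family nonempty.\<close>
  define V where "V = from_nat_into (insert (\<lambda>n. {}) \<W>)"
  have range_V: "range V = insert (\<lambda>n. {}) \<W>"
    unfolding V_def by (rule range_from_nat_into) (use \<W> in auto)
  then have "range V \<subseteq> \<V>"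
    using \<W>(2) \<open>(\<lambda>n. {}) \<in> \<V>\<close> by simp
  then have V: "V k n \<in> \<U> n" for k n
    by (auto simp: \<V>_def)
  have "topspace X \<subseteq> (\<Union>n. V n n)"
  proof
    fix x assume "x \<in> topspace X"
    then obtain W where W: "W \<in> \<W>" "\<And>n. x \<in> W n"
      unfolding \<C>(3)[symmetric] \<W>(3) by auto
    then have "W \<in> range V"
      using range_V by simp
    then obtain k where "W = V k"
      by (rule rangeE)
    then show "x \<in> (\<Union>n. V n n)"
      \<comment> \<open>The point \<open>x\<close> lies in every term of \<open>V k\<close>, in
        particular in the diagonal term \<open>V k k\<close>.\<close>
      using W(2) by blast
  qed
  moreover have "openin X (V n n)" for n
    by (rule opn[OF V])
  then have "(\<Union>n. V n n) \<subseteq> topspace X"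
    by (intro UN_least openin_subset)
  ultimately have "open_cover_of X (range (\<lambda>n. V n n))"
    using \<open>\<And>n. openin X (V n n)\<close> by (simp add: open_cover_of_def subset_antisym)
  then show "\<exists>U. (\<forall>n. U n \<in> \<U> n) \<and> open_cover_of X (range U)"
    using V by (intro exI[of _ "\<lambda>n. V n n"]) simp
qed

end
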